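(* Let $t$ be a quantitative transaction and let $\mathcal{V}_t$ be its upper triangle utility. For all positive integers $\ell$ and $i$ such that $\ell \le i \le |t|$, $$\mathcal{V}_t(\ell,i)=\binom{i-1}{\ell-1}\,\mathcal{V}_t(1,i).$$
   Context: Items come from a finite totally ordered set. A quantitative transaction $t$ is a finite set of $|t|$ distinct items, listed in this order as $t[1],\dots,t[|t|]$. Each item $X\in t$ carries a quantity $q(X,t)$ (a real number), and each item $X$ has a user-defined weight $p(X)>0$. The weight of $X$ in $t$ is $\omega(X,t)=q(X,t)\,p(X)$. The upper triangle utility $\mathcal{V}_t$ of $t$ is the function of integers $\ell,i$ with $0<\ell,i\le |t|$ defined recursively by: - $\mathcal{V}_t(\ell,i)=0$ if $\ell>i$; - $\mathcal{V}_t(1,i)=\sum_{j=1}^{i}\omega(t[j],t)$; - $\mathcal{V}_t(\ell,i)=\binom{i-1}{\ell-1}\,\omega(t[i],t)+\mathcal{V}_t(\ell-1,i-1)+\mathcal{V}_t(\ell,i-1)$ for $2\le \ell\le i$. *)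

theory Defs
  imports Complex_Main
begin

text \<open>Only the values of the quantity function on the item set of the transaction are meaningful.\<close>

record 'a transaction =
  items :: "'a set"
  quantity :: "'a \<Rightarrow> real"

definition is_transaction :: "'a set \<Rightarrow> 'a transaction \<Rightarrow> bool" where
  "is_transaction I t \<longleftrightarrow> finite (items t) \<and> items t \<subseteq> I"

definition tsize :: "'a transaction \<Rightarrow> nat" where
  "tsize t = card (items t)"

text \<open>Positions are counted from 1, while list positions are counted from 0.\<close>

definition item_at :: "'a::linorder transaction \<Rightarrow> nat \<Rightarrow> 'a" where
  "item_at t j = sorted_list_of_set (items t) ! (j - 1)"

definition weight_in :: "('a \<Rightarrow> real) \<Rightarrow> 'a \<Rightarrow> 'a transaction \<Rightarrow> real" where
  "weight_in p X t = quantity t X * p X"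

text \<open>
  The utility is specified only for indices between 1 and the size of the transaction; outside
  this range the value is left unspecified. The recursive calls never leave the range.
\<close>

fun upper_triangle_utility ::
    "('a::linorder \<Rightarrow> real) \<Rightarrow> 'a transaction \<Rightarrow> nat \<Rightarrow> nat \<Rightarrow> real" where
  "upper_triangle_utility p t l i =
    (if \<not> (0 < l \<and> l \<le> tsize t \<and> 0 < i \<and> i \<le> tsize t) then undefined
     else if l > i then 0
     else if l = 1 then (\<Sum>j = 1..i. weight_in p (item_at t j) t)
     else real ((i - 1) choose (l - 1)) * weight_in p (item_at t i) t
          + upper_triangle_utility p t (l - 1) (i - 1)
          + upper_triangle_utility p t l (i - 1))"

declare upper_triangle_utility.simps [simp del]

end

theory Submission
  imports Defs
begin

text \<open>Each entry is a binomial multiple of a prefix sum of weights. Let \<open>S\<close> be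
  the sum of the first \<open>i - 1\<close> weights and \<open>w\<close> the weight at position
  \<open>i\<close>. By induction on \<open>i\<close>, the two recursive terms contribute
  \<open>(i-2 choose l-2) * S\<close> and \<open>(i-2 choose l-1) * S\<close>, which Pascal's rule
  merges into \<open>(i-1 choose l-1) * S\<close>. The explicit term has the same coefficient on
  \<open>w\<close>, so it extends the prefix sum by one position. The induction covers
  \<open>l > i\<close> as well, where both sides vanish; the row bound keeps every entry in the
  specified range.\<close>

lemma upper_triangle_utility_Suc_Suc:
  assumes "Suc k \<le> tsize t" and "Suc n \<le> tsize t"
  shows "upper_triangle_utility p t (Suc k) (Suc n) =
    real (n choose k) * (\<Sum>j = 1..Suc n. weight_in p (item_at t j) t)"
  using assms
\<comment> \<open>The recursion refers to two different rows of the previous column, so the row must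
  vary.\<close>
proof (induction n arbitrary: k)
  case 0
  then show ?case
    by (cases k) (simp_all add: upper_triangle_utility.simps)
next
  case (Suc n)
  show ?case
  proof (cases k)
    case 0
    with Suc.prems show ?thesis
      by (simp add: upper_triangle_utility.simps)
  next
    case (Suc m)
    show ?thesis
    proof (cases "m \<le> n")
      case True
      let ?w = "\<lambda>j. weight_in p (item_at t j) t"
      have "upper_triangle_utility p t (Suc k) (Suc (Suc n)) =
          real (Suc n choose k) * ?w (Suc (Suc n))
          + upper_triangle_utility p t (Suc m) (Suc n)
          + upper_triangle_utility p t (Suc k) (Suc n)"
        using True Suc Suc.prems
        by (subst upper_triangle_utility.simps) simp
      also have "upper_triangle_utility p t (Suc m) (Suc n) =
          real (n choose m) * (\<Sum>j = 1..Suc n. ?w j)"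
        using Suc Suc.prems by (intro Suc.IH) simp_all
      \<comment> \<open>On the diagonal, \<open>m = n\<close>, this entry has row greater than
        column; the hypothesis still applies and gives 0 because
        \<open>n choose k = 0\<close>.\<close>
      also have "upper_triangle_utility p t (Suc k) (Suc n) =
          real (n choose k) * (\<Sum>j = 1..Suc n. ?w j)"
        using Suc.prems by (intro Suc.IH) simp_all
      \<comment> \<open>Pascal's rule for \<open>Suc n choose Suc m\<close> combines the two
        multiples of the prefix sum.\<close>
      finally show ?thesis
        using Suc by (simp add: algebra_simps)
    next
      case False
      with Suc Suc.prems show ?thesis
        by (simp add: upper_triangle_utility.simps binomial_eq_0)
    qed
  qed
qed

theorem theorem1:
  fixes I :: "'a::linorder set"
    and p :: "'a \<Rightarrow> real"
    and t :: "'a transaction"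
    and l i :: nat
  assumes "finite I"
    and "\<And>X. X \<in> I \<Longrightarrow> p X > 0"
    and "is_transaction I t"
    and "0 < l" and "0 < i"
    and "l \<le> i" and "i \<le> tsize t"
  shows "upper_triangle_utility p t l i =
    real ((i - 1) choose (l - 1)) * upper_triangle_utility p t 1 i"
proof -
  obtain k n where "l = Suc k" "i = Suc n"
    using assms(4,5) gr0_implies_Suc by blast
  with assms(6,7) show ?thesis
    \<comment> \<open>The instance with 0 identifies the prefix sum with row 1, since
      \<open>n choose 0 = 1\<close>.\<close>
    using upper_triangle_utility_Suc_Suc[of k t n p] upper_triangle_utility_Suc_Suc[of 0 t n p]
    by simp
qed

end
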